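(* Let $N_1,N_2$ be positive integers. The minimal number of DFT coefficients required to uniquely recover an $N_1\times N_2$ integer matrix is the number of cyclic subgroups of $\mathbb{Z}_{N_1}\times\mathbb{Z}_{N_2}$. That is, the minimum of $|S|$ over all sets of frequencies $S$ that suffice for unique recovery of $N_1\times N_2$ integer matrices equals the number of cyclic subgroups of $\mathbb{Z}_{N_1}\times\mathbb{Z}_{N_2}$.
   Context: $\mathbb{Z}_N$ denotes the additive cyclic group $\mathbb{Z}/N\mathbb{Z}$. Matrix entries $X_{mn}$ are indexed by $0\le m<N_1$, $0\le n<N_2$. The two-dimensional DFT of an $N_1\times N_2$ matrix $X$ is $\tilde X_{kl}=\sum_{m=0}^{N_1-1}\sum_{n=0}^{N_2-1}X_{mn}\,e^{-2\pi i\left(\frac{mk}{N_1}+\frac{nl}{N_2}\right)}$, for frequencies $(k,l)$ with $0\le k<N_1$, $0\le l<N_2$. A set $S\subseteq\{0,\dots,N_1-1\}\times\{0,\dots,N_2-1\}$ of frequencies suffices for unique recovery of $N_1\times N_2$ integer matrices if, for any two $N_1\times N_2$ integer matrices $X,Y$, the equalities $\tilde X_{kl}=\tilde Y_{kl}$ for all $(k,l)\in S$ imply $X=Y$. *)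

theory Defs
  imports
    Complex_Main
    "HOL-Algebra.Elementary_Groups"
    "Jordan_Normal_Form.Matrix"
begin

definition dft2 :: "nat \<Rightarrow> nat \<Rightarrow> int mat \<Rightarrow> nat \<Rightarrow> nat \<Rightarrow> complex" where
  "dft2 N1 N2 X k l =
     (\<Sum>m<N1. \<Sum>n<N2. of_int (X $$ (m, n)) *
        exp (- 2 * of_real pi * \<i> *
          (of_nat m * of_nat k / of_nat N1 + of_nat n * of_nat l / of_nat N2)))"

definition suffices_for_recovery :: "nat \<Rightarrow> nat \<Rightarrow> (nat \<times> nat) set \<Rightarrow> bool" where
  "suffices_for_recovery N1 N2 S \<longleftrightarrow>
     S \<subseteq> {..<N1} \<times> {..<N2} \<and>
     (\<forall>X \<in> carrier_mat N1 N2. \<forall>Y \<in> carrier_mat N1 N2.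
        (\<forall>(k, l) \<in> S. dft2 N1 N2 X k l = dft2 N1 N2 Y k l) \<longrightarrow> X = Y)"

definition cyclic_subgroups :: "('a, 'b) monoid_scheme \<Rightarrow> 'a set set" where
  "cyclic_subgroups G = {H. subgroup H G \<and> cyclic_group (G\<lparr>carrier := H\<rparr>)}"

end

theory Submission
  imports Defs
    "HOL-Computational_Algebra.Polynomial"
    "HOL-Computational_Algebra.Primes"
    "HOL-Number_Theory.Cong"
begin

text \<open>
  The result rests on a description of all sufficient sets: a set \<open>S\<close> of frequencies suffices for
  unique recovery of integer matrices iff every cyclic subgroup of the frequency group
  \<open>\<int>/N1 \<times> \<int>/N2\<close> has a generator in \<open>S\<close> (\<open>suffices_for_recovery_iff\<close>). A smallest such set
  contains exactly one generator of each cyclic subgroup. Two frequencies \<open>g\<close> and \<open>h\<close> generate the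
  same subgroup iff \<open>h = r g\<close> for some \<open>r\<close> coprime to \<open>N1 N2\<close>.

  For sufficiency, let \<open>Z\<close> be the difference of two integer matrices. The coefficient of \<open>Z\<close> at
  \<open>g\<close> is \<open>P w\<close> for an integer polynomial \<open>P\<close> and a primitive root of unity \<open>w\<close> of order \<open>N1 N2\<close>,
  and the coefficient at \<open>r g\<close> is \<open>P (w ^ r)\<close>. Galois conjugation shows that both vanish or neither
  does (\<open>coprime_power_map_preserves_vanishing\<close>); this is the irreducibility of the cyclotomic
  polynomials in disguise, and it is proved by Dedekind's argument modulo a prime. So if the
  coefficients of \<open>Z\<close> vanish on \<open>S\<close>, they all vanish, and \<open>Z = 0\<close> by Fourier inversion.

  For necessity, fix a frequency \<open>h\<close> and let \<open>X\<close> be the sum of the characters attached to \<open>r h\<close>, for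
  \<open>r\<close> running over the units modulo \<open>N1 N2\<close>. Its entries are sums of \<open>z ^ r\<close> over the units \<open>r\<close>,
  with \<open>z\<close> a root of unity. Such Ramanujan sums are integers (\<open>sum_coprime_powers_in_Ints\<close>).
  By orthogonality, the transform of \<open>X\<close> lives on the generators of the subgroup of \<open>h\<close>. A set
  \<open>S\<close> without any of these generators cannot tell \<open>X\<close> from the zero matrix.
\<close>

section \<open>Evaluating integer polynomials\<close>

abbreviation eval_at :: "int poly \<Rightarrow> 'a::comm_ring_1 \<Rightarrow> 'a" where
  "eval_at P x \<equiv> poly (map_poly of_int P) x"

lemma eval_at_pCons: "eval_at (pCons a P) x = of_int a + x * eval_at P x"
  by (simp add: map_poly_pCons)

lemma eval_at_add: "eval_at (P + Q) x = eval_at P x + eval_at Q x"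
proof (induction P Q rule: poly_induct2)
  case (pCons a P b Q)
  then show ?case by (simp only: add_pCons eval_at_pCons) (simp add: algebra_simps)
qed simp

lemma eval_at_smult: "eval_at (smult c P) x = of_int c * eval_at P x"
proof (induction P)
  case (pCons a P)
  then show ?case by (simp only: smult_pCons eval_at_pCons) (simp add: algebra_simps)
qed simp

lemma eval_at_minus: "eval_at (- P) x = - eval_at P x"
  using eval_at_smult[of "-1" P x] by simp

lemma eval_at_diff: "eval_at (P - Q) x = eval_at P x - eval_at Q x"
  using eval_at_add[of P "-Q" x] by (simp add: eval_at_minus)

lemma eval_at_mult: "eval_at (P * Q) x = eval_at P x * eval_at Q x"
proof (induction P)
  case (pCons a P)
  then show ?case
    by (simp only: mult_pCons_left eval_at_pCons eval_at_add eval_at_smult)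
       (simp add: algebra_simps)
qed simp

lemma eval_at_power: "eval_at (P ^ n) x = eval_at P x ^ n"
proof (induction n)
  case (Suc n)
  then show ?case by (simp only: power_Suc eval_at_mult)
qed simp

lemma eval_at_monom: "eval_at (monom c n) x = of_int c * x ^ n"
  by (simp add: map_poly_monom poly_monom)

lemma eval_at_sum: "eval_at (sum f A) x = (\<Sum>i\<in>A. eval_at (f i) x)"
  by (induction A rule: infinite_finite_induct) (simp_all add: eval_at_add)

lemma eval_at_pcompose: "eval_at (pcompose P Q) x = eval_at P (eval_at Q x)"
proof (induction P)
  case (pCons a P)
  then show ?case
    by (simp only: pcompose_pCons eval_at_pCons eval_at_add eval_at_mult) simp
qed simp

lemmas eval_at_simps = eval_at_pCons eval_at_add eval_at_smult eval_at_minus eval_at_diff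
  eval_at_mult eval_at_power eval_at_monom eval_at_pcompose

section \<open>Galois conjugation of roots of unity\<close>

text \<open>By Gauss's lemma the cofactor of \<open>f\<close> in \<open>smult a P\<close> has content \<open>\<bar>a\<bar> * content P\<close>, so it is
  divisible by \<open>a\<close>.\<close>
lemma primitive_dvd_smult_cancel:
  fixes f P :: "int poly"
  assumes "content f = 1" "a \<noteq> 0" "f dvd smult a P"
  shows "f dvd P"
proof -
  from assms(3) obtain q where q: "smult a P = f * q" by (blast elim: dvdE)
  have "content q = \<bar>a\<bar> * content P"
    using arg_cong[OF q, of content] assms(1) by (simp add: content_mult)
  hence "smult a P = f * smult (\<bar>a\<bar> * content P) (primitive_part q)"
    using q by (metis content_times_primitive_part)
  also have "\<dots> = smult a (f * smult (sgn a * content P) (primitive_part q))"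
  proof -
    have "\<bar>a\<bar> * content P = a * (sgn a * content P)"
      by (metis abs_sgn mult.assoc)
    thus ?thesis by (simp only: mult_smult_right smult_smult)
  qed
  finally have "P = f * smult (sgn a * content P) (primitive_part q)"
    using assms(2) by (simp add: poly_eq_iff)
  thus ?thesis by (rule dvdI)
qed

text \<open>The primitive polynomial of least degree that vanishes at \<open>w\<close>: pseudo-division by it leaves
  remainder zero, and primitivity removes the integer factor which pseudo-division introduces.\<close>
lemma minimal_integer_polynomial:
  fixes w :: complex
  assumes "A \<noteq> 0" "eval_at A w = 0"
  obtains f where "f \<noteq> 0" "eval_at f w = 0" "\<And>P. eval_at P w = 0 \<Longrightarrow> f dvd P"
proof -
  obtain h where h: "h \<noteq> 0" "eval_at h w = 0"
    and least: "\<And>P. P \<noteq> 0 \<Longrightarrow> eval_at P w = 0 \<Longrightarrow> degree h \<le> degree P"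
    using ex_has_least_nat[of "\<lambda>P. P \<noteq> 0 \<and> eval_at P w = 0" A degree] assms by blast
  define f where "f = primitive_part h"
  have hf: "h = smult (content h) f" by (simp add: f_def)
  have f: "f \<noteq> 0" "content f = 1" "degree f = degree h"
    using h(1) by (auto simp: f_def)
  have f0: "eval_at f w = 0"
    using h hf by (metis eval_at_smult content_eq_zero_iff mult_eq_0_iff of_int_eq_0_iff)
  have "f dvd P" if P: "eval_at P w = 0" for P
  proof -
    obtain a q where aq: "a \<noteq> 0" "smult a P = f * q + pseudo_mod P f"
      using pseudo_mod(1)[OF f(1), of P] by blast
    have "eval_at (pseudo_mod P f) w = 0"
      using arg_cong[OF aq(2), of "\<lambda>Q. eval_at Q w"] f0 P by (simp add: eval_at_simps)
    hence "pseudo_mod P f = 0"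
      using pseudo_mod(2)[OF f(1), of P] least[of "pseudo_mod P f"] f(3) by fastforce
    hence "smult a P = f * q" using aq(2) by simp
    hence "f dvd smult a P" by (rule dvdI)
    thus ?thesis by (rule primitive_dvd_smult_cancel[OF f(2) aq(1)])
  qed
  with f(1) f0 show ?thesis by (rule that)
qed

text \<open>The Frobenius congruence, as divisibility by \<open>p\<close>: in this form it can be applied
  in \<open>\<int>[x]\<close> itself and then evaluated at a complex number.\<close>
lemma power_prime_add_cong:
  fixes a b :: "'a::comm_ring_1"
  assumes "prime p"
  shows "of_nat p dvd (a + b) ^ p - (a ^ p + b ^ p)"
proof -
  have p: "p > 0" using assms prime_gt_0_nat by blast
  have "(a + b) ^ p = (\<Sum>k\<le>p. of_nat (p choose k) * a ^ k * b ^ (p - k))"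
    by (rule binomial_ring)
  also have "{..p} = insert 0 (insert p {0<..<p})" using p by auto
  finally have "(a + b) ^ p - (a ^ p + b ^ p) =
      (\<Sum>k\<in>{0<..<p}. of_nat (p choose k) * a ^ k * b ^ (p - k))"
    using p by simp
  moreover have "of_nat p dvd (of_nat (p choose k) :: 'a)" if "k \<in> {0<..<p}" for k
  proof -
    have "p dvd (p choose k)"
      using that assms by (intro dvd_choose_prime) auto
    thus ?thesis by (metis dvd_def of_nat_mult)
  qed
  ultimately show ?thesis by (auto simp: mult.assoc intro!: dvd_sum dvd_mult2)
qed

lemma int_power_prime_cong:
  fixes a :: int
  assumes "prime p"
  shows "int p dvd a ^ p - a"
proof -
  have *: "int p dvd int n ^ p - int n" for n
  proof (induction n)
    case 0
    then show ?case using assms prime_gt_0_nat by (simp add: power_0_left)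
  next
    case (Suc n)
    have "int (Suc n) ^ p - int (Suc n) =
        ((int n + 1) ^ p - (int n ^ p + 1 ^ p)) + (int n ^ p - int n)"
      by (simp add: algebra_simps)
    moreover have "int p dvd (int n + 1) ^ p - (int n ^ p + 1 ^ p)"
      using power_prime_add_cong[OF assms, of "int n" 1] by simp
    ultimately show ?case using Suc by (metis dvd_add)
  qed
  show ?thesis
  proof (cases "a \<ge> 0")
    case True
    thus ?thesis using *[of "nat a"] by simp
  next
    case False
    have "int p dvd (a + (- a)) ^ p - (a ^ p + (-a) ^ p)"
      using power_prime_add_cong[OF assms, of a "-a"] by simp
    hence "int p dvd - (a ^ p + (-a) ^ p)"
      using assms prime_gt_0_nat by (simp add: power_0_left)
    hence "int p dvd a ^ p + (-a) ^ p"
      by (simp only: dvd_minus_iff)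
    moreover have "int p dvd (-a) ^ p - (-a)"
      using *[of "nat (-a)"] False by simp
    ultimately have "int p dvd (a ^ p + (-a) ^ p) - ((-a) ^ p - (-a))"
      by (rule dvd_diff)
    thus ?thesis by simp
  qed
qed

lemma pcompose_monom_prime_cong:
  fixes g :: "int poly"
  assumes "prime p"
  shows "of_nat p dvd pcompose g (monom 1 p) - g ^ p"
proof (induction g)
  case 0
  then show ?case using assms prime_gt_0_nat by (simp add: power_0_left)
next
  case (pCons a g)
  let ?x = "monom (1::int) 1"
  have eq: "pCons a g = [:a:] + ?x * g"
    by (simp add: monom_Suc)
  have 1: "of_nat p dvd (pCons a g) ^ p - ([:a:] ^ p + (?x * g) ^ p)"
    unfolding eq by (rule power_prime_add_cong[OF assms])
  have 2: "of_nat p dvd [:a ^ p:] - [:a:]"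
  proof -
    obtain c where "a ^ p - a = int p * c"
      using int_power_prime_cong[OF assms, of a] by (blast elim: dvdE)
    hence "[:a ^ p:] - [:a:] = of_nat p * [:c:]"
      by (simp add: of_nat_poly)
    thus ?thesis by (metis dvd_triv_left)
  qed
  have "pcompose (pCons a g) (monom 1 p) - pCons a g ^ p =
     monom 1 p * (pcompose g (monom 1 p) - g ^ p)
     - ([:a ^ p:] - [:a:])
     - ((pCons a g) ^ p - ([:a:] ^ p + (?x * g) ^ p))"
    by (simp add: pcompose_pCons power_mult_distrib monom_power poly_const_pow algebra_simps)
  also have "of_nat p dvd \<dots>"
    by (rule dvd_diff[OF dvd_diff[OF dvd_mult[OF pCons.IH] 2] 1])
  finally show ?case .
qed

text \<open>Dedekind's argument. Let \<open>f\<close> be the minimal integer polynomial of \<open>w\<close> and \<open>x^N - 1 = f g\<close>. If \<open>P\<close>,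
  a multiple of \<open>f\<close>, did not vanish at \<open>w ^ p\<close>, then \<open>g\<close> would, and the Frobenius congruence would
  give \<open>g(w) ^ p \<in> p \<int>[w]\<close>. Differentiating \<open>x^N - 1 = f g\<close> shows that \<open>g(w)\<close> divides \<open>N\<close> in
  \<open>\<int>[w]\<close>, so \<open>N ^ p \<in> p \<int>[w]\<close>. As \<open>f\<close> has leading coefficient 1 or -1, remainders modulo \<open>f\<close>
  exist over the integers and \<open>\<int>[w]\<close> has a basis that contains 1. Hence \<open>p\<close> divides \<open>N ^ p\<close>
  already in \<open>\<int>\<close>, contrary to \<open>p\<close> not dividing \<open>N\<close>.\<close>
lemma prime_power_map_preserves_vanishing:
  fixes w :: complex
  assumes w: "w ^ N = 1" and N: "N > 0" and p: "prime p" "\<not> p dvd N"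
    and P: "eval_at P w = 0"
  shows "eval_at P (w ^ p) = 0"
proof (rule ccontr)
  assume nz: "eval_at P (w ^ p) \<noteq> 0"
  define A :: "int poly" where "A = monom 1 N - 1"
  have "coeff A N = 1" using N by (simp add: A_def)
  hence A0: "A \<noteq> 0" by auto
  have A_eval: "eval_at A z = z ^ N - 1" for z :: complex
    by (simp add: A_def eval_at_simps)
  obtain f where f: "f \<noteq> 0" "eval_at f w = 0" "\<And>P. eval_at P w = 0 \<Longrightarrow> f dvd P"
    using minimal_integer_polynomial[OF A0, of w] A_eval w by auto
  obtain g where g: "A = f * g" using f(3)[of A] A_eval w by auto
  obtain q where q: "P = f * q" using f(3)[OF P] by auto
  have "eval_at A (w ^ p) = 0"
    using w by (simp add: A_eval power_mult [symmetric] mult.commute[of p])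
       (simp add: power_mult)
  with nz q g have gp: "eval_at g (w ^ p) = 0" by (auto simp: eval_at_simps)
  obtain u where u: "pcompose g (monom 1 p) - g ^ p = of_nat p * u"
    using pcompose_monom_prime_cong[OF p(1)] by (blast elim: dvdE)
  have "- (eval_at g w ^ p) = of_nat p * eval_at u w"
    using arg_cong[OF u, of "\<lambda>Q. eval_at Q w"] gp
    by (simp add: eval_at_simps of_nat_poly)
  hence gw: "eval_at g w ^ p = - of_nat p * eval_at u w"
    by (metis minus_minus mult_minus_left)
  \<comment> \<open>The derivative of \<open>A\<close>, multiplied by \<open>x\<close>, is \<open>N x^N = N (A + 1)\<close>.\<close>
  have "monom 1 1 * pderiv A = of_nat N * (f * g + 1)"
    unfolding g [symmetric] using N
    by (simp add: A_def pderiv_diff pderiv_monom mult_monom of_nat_poly smult_monom)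
  moreover have "pderiv A = f * pderiv g + pderiv f * g"
    by (simp add: g pderiv_mult)
  ultimately have "of_nat N * (f * g + 1) = monom 1 1 * (f * pderiv g + pderiv f * g)"
    by simp
  from arg_cong[OF this, of "\<lambda>Q. eval_at Q w"] f(2)
  have Nw: "of_nat N = w * eval_at (pderiv f) w * eval_at g w"
    by (simp add: eval_at_simps of_nat_poly)
  \<comment> \<open>The element of \<open>\<int>[w]\<close> that witnesses \<open>N ^ p \<in> p \<int>[w]\<close>.\<close>
  define B where "B = - ((monom 1 1 * pderiv f) ^ p * u)"
  have NB: "of_nat N ^ p = of_nat p * eval_at B w"
    unfolding Nw by (simp add: B_def eval_at_simps power_mult_distrib gw)
  have "lead_coeff f * lead_coeff g = 1"
  proof -
    have "degree A = N"
    proof (rule antisym)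
      show "degree A \<le> N"
        unfolding A_def by (rule degree_diff_le) (simp_all add: degree_monom_eq)
      show "N \<le> degree A"
        using \<open>coeff A N = 1\<close> by (intro le_degree) simp
    qed
    hence "lead_coeff A = 1" using \<open>coeff A N = 1\<close> by simp
    thus ?thesis by (simp add: g lead_coeff_mult)
  qed
  hence lc: "lead_coeff f = 1 \<or> lead_coeff f = -1"
    by (metis zmult_eq_1_iff)
  obtain q r where qr: "pseudo_divmod B f = (q, r)" by fastforce
  define c where "c = lead_coeff f ^ (Suc (degree B) - degree f)"
  have cc: "c * c = 1"
    using lc by (auto simp: c_def power_mult_distrib [symmetric])
  have div: "smult c B = f * q + r" "r = 0 \<or> degree r < degree f"
    using pseudo_divmod[OF f(1) qr] by (auto simp: c_def)
  have "degree f \<noteq> 0"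
  proof
    assume "degree f = 0"
    then obtain a where "f = [:a:]" by (elim degree_eq_zeroE)
    thus False using f(1,2) by (simp add: eval_at_pCons)
  qed
  \<comment> \<open>This polynomial vanishes at \<open>w\<close> and has smaller degree than \<open>f\<close>, hence it is zero.\<close>
  let ?R = "[:c * int N ^ p:] - smult (int p) r"
  have "of_int c * eval_at B w = eval_at r w"
    using arg_cong[OF div(1), of "\<lambda>Q. eval_at Q w"] f(2) by (simp add: eval_at_simps)
  hence "eval_at ?R w = 0"
    using NB by (simp add: eval_at_simps algebra_simps)
  hence "f dvd ?R" by (rule f(3))
  moreover have "degree ?R < degree f"
    using div(2) \<open>degree f \<noteq> 0\<close> by (intro degree_diff_less) auto
  ultimately have "?R = 0" using dvd_imp_degree_le linorder_not_less by blast
  hence "coeff ?R 0 = 0" by simp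
  hence "c * int N ^ p = int p * coeff r 0" by simp
  hence "int N ^ p = int p * (c * coeff r 0)"
    using cc by (metis mult.assoc mult.commute mult.left_neutral)
  hence "int p dvd int N ^ p" by simp
  hence "p dvd N ^ p" by (metis of_nat_dvd_iff of_nat_power)
  thus False using p prime_dvd_power by blast
qed

text \<open>Raise to the prime factors of \<open>r\<close> one after the other. The induction goes on because the
  powers of \<open>w\<close> are again roots of \<open>x^N - 1\<close>.\<close>
lemma coprime_power_map_preserves_vanishing:
  fixes w :: complex
  assumes "w ^ N = 1" "N > 0" "coprime r N" "eval_at P w = 0"
  shows "eval_at P (w ^ r) = 0"
  using assms
proof (induction r arbitrary: w rule: prime_divisors_induct)
  case zero
  then show ?case by simp
next
  case (unit x)
  then show ?case by simp
next
  case (factor p x)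
  have "(w ^ p) ^ N = 1"
    using factor.prems(1) by (metis mult.commute power_mult power_one)
  moreover have "eval_at P (w ^ p) = 0"
    using factor by (intro prime_power_map_preserves_vanishing[of w N])
      (auto simp: prime_imp_coprime coprime_absorb_left)
  ultimately have "eval_at P ((w ^ p) ^ x) = 0"
    using factor by (intro factor.IH) auto
  thus ?case by (simp add: power_mult)
qed

section \<open>Ramanujan sums\<close>

lemma sum_powers_root_of_unity:
  fixes w :: complex
  assumes "w ^ N = 1"
  shows "(\<Sum>j<N. w ^ j) = (if w = 1 then of_nat N else 0)"
  using assms by (simp add: geometric_sum)

text \<open>The full sum over \<open>r < N\<close> is \<open>N\<close> or 0. Grouping it by \<open>d = gcd r N\<close> splits it into the sums of
  the same kind for \<open>w ^ d\<close> and \<open>N div d\<close>, which are integers by induction for \<open>d > 1\<close>; the group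
  for \<open>d = 1\<close> is the sum in question.\<close>
lemma sum_coprime_powers_in_Ints:
  fixes w :: complex
  assumes "w ^ N = 1" "N > 0"
  shows "(\<Sum>r | r < N \<and> coprime r N. w ^ r) \<in> \<int>"
  using assms
proof (induction N arbitrary: w rule: less_induct)
  case (less N)
  let ?C = "\<lambda>d. {r. r < N \<and> gcd r N = d}"
  have C: "(\<Sum>r\<in>?C d. w ^ r) =
      (\<Sum>r | r < N div d \<and> coprime r (N div d). (w ^ d) ^ r)" if dN: "d dvd N" for d
  proof -
    have d: "d > 0" using dN less.prems(2) by (meson dvd_pos_nat)
    obtain m where m: "N = d * m" using dN by (blast elim: dvdE)
    have "bij_betw (\<lambda>r. d * r) {r. r < m \<and> coprime r m} (?C d)"
    proof (rule bij_betwI[where g = "\<lambda>r. r div d"], goal_cases)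
      case 1
      show ?case using d by (auto simp: m gcd_mult_distrib_nat [symmetric])
    next
      case 2
      show ?case
      proof (intro Pi_I)
        fix r assume "r \<in> ?C d"
        hence r: "r < N" "gcd r N = d" by auto
        hence "d dvd r" by (metis gcd_dvd1)
        then obtain s where s: "r = d * s" by (blast elim: dvdE)
        have "s < m" using r(1) d s m by simp
        moreover have "coprime s m"
          using r(2) d s m by (simp add: gcd_mult_distrib_nat [symmetric] coprime_iff_gcd_eq_1)
        ultimately show "r div d \<in> {r. r < m \<and> coprime r m}" using s d by simp
      qed
    next
      case (3 r)
      then show ?case using d by simp
    next
      case (4 r)
      then show ?case by auto
    qed
    from sum.reindex_bij_betw[OF this, of "\<lambda>r. w ^ r"] show ?thesis
      using d by (simp add: m power_mult)
  qed
  have fin: "finite {d. d dvd N}" using less.prems(2) by simp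
  have "(\<Sum>j<N. w ^ j) = (\<Sum>d | d dvd N. \<Sum>r\<in>{r\<in>{..<N}. gcd r N = d}. w ^ r)"
    by (rule sum.group [symmetric]) (use fin in auto)
  also have "\<dots> = (\<Sum>d | d dvd N. \<Sum>r\<in>?C d. w ^ r)"
    by (intro sum.cong) auto
  also have "\<dots> = (\<Sum>r\<in>?C 1. w ^ r) + (\<Sum>d\<in>{d. d dvd N} - {1}. \<Sum>r\<in>?C d. w ^ r)"
    using fin by (intro sum.remove) auto
  finally have "(\<Sum>r\<in>?C 1. w ^ r) =
      (\<Sum>j<N. w ^ j) - (\<Sum>d\<in>{d. d dvd N} - {1}. \<Sum>r\<in>?C d. w ^ r)"
    by simp
  also have "\<dots> \<in> \<int>"
  proof (rule Ints_diff)
    show "(\<Sum>j<N. w ^ j) \<in> \<int>"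
      using sum_powers_root_of_unity[OF less.prems(1)] by auto
    show "(\<Sum>d\<in>{d. d dvd N} - {1}. \<Sum>r\<in>?C d. w ^ r) \<in> \<int>"
    proof (rule Ints_sum)
      fix d assume d: "d \<in> {d. d dvd N} - {1}"
      hence "d > 1" using less.prems(2) by (cases "d = 0") auto
      have "(w ^ d) ^ (N div d) = 1"
        using d less.prems(1) by (simp add: power_mult [symmetric])
      hence "(\<Sum>r | r < N div d \<and> coprime r (N div d). (w ^ d) ^ r) \<in> \<int>"
        using d \<open>d > 1\<close> less.prems(2)
        by (intro less.IH) (auto simp: dvd_imp_le div_greater_zero_iff)
      thus "(\<Sum>r\<in>?C d. w ^ r) \<in> \<int>" using C[of d] d by simp
    qed
  qed
  finally show ?case by (simp add: coprime_iff_gcd_eq_1)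
qed

section \<open>Lifting units\<close>

text \<open>A unit modulo \<open>D\<close> lifts to a unit modulo \<open>N\<close>. Take for \<open>t\<close> the product of the primes that divide
  \<open>N\<close> but not \<open>a\<close>: each prime divisor of \<open>N\<close> then divides exactly one of \<open>a\<close> and \<open>D * t\<close>.\<close>
lemma coprime_lift:
  fixes a D :: int
  assumes "coprime a D" "N > 0"
  obtains t where "coprime (a + D * t) (int N)"
proof
  define T where "T = {p. prime p \<and> p dvd N \<and> \<not> int p dvd a}"
  define t where "t = int (\<Prod>T)"
  have fin: "finite T"
    unfolding T_def by (rule finite_subset[of _ "{p. p dvd N}"]) (use assms(2) in auto)
  show "coprime (a + D * t) (int N)"
  proof (rule ccontr)
    assume "\<not> coprime (a + D * t) (int N)"
    hence "gcd (a + D * t) (int N) \<noteq> 1" by (simp add: coprime_iff_gcd_eq_1)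
    hence "\<not> is_unit (gcd (a + D * t) (int N))" by simp
    moreover have "gcd (a + D * t) (int N) \<noteq> 0" using assms(2) by simp
    ultimately obtain q where q: "prime q" "q dvd gcd (a + D * t) (int N)"
      using prime_divisor_exists by blast
    hence q: "prime q" "q dvd a + D * t" "q dvd int N" by simp_all
    define p where "p = nat q"
    have qp: "q = int p" and p: "prime p"
      using q(1) by (simp_all add: p_def prime_ge_0_int)
    have pN: "p dvd N" using q(3) qp by simp
    show False
    proof (cases "q dvd a")
      case True
      hence "q dvd D * t" using q(2) by (simp add: dvd_add_right_iff)
      moreover have "\<not> q dvd D"
        using True q(1) assms(1) by (meson coprime_common_divisor not_prime_unit)
      ultimately have "q dvd t" using q(1) prime_dvd_mult_iff by blast
      hence "p dvd \<Prod>T" by (metis of_nat_dvd_iff qp t_def)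
      then obtain p' where "p' \<in> T" "p dvd p'"
        using p fin by (auto simp: prime_dvd_prod_iff)
      hence "p \<in> T" using p by (metis (mono_tags) T_def mem_Collect_eq primes_dvd_imp_eq)
      thus False using True qp by (simp add: T_def)
    next
      case False
      hence "p \<in> T" using p pN qp by (simp add: T_def)
      hence "p dvd \<Prod>T" using fin dvd_prodI[of T p "\<lambda>x. x"] by simp
      hence "q dvd t" by (metis of_nat_dvd_iff qp t_def)
      thus False using False q(2) by (simp add: dvd_add_left_iff)
    qed
  qed
qed

section \<open>The discrete Fourier transform\<close>

definition unity_root :: "nat \<Rightarrow> complex" where
  "unity_root N = exp (- 2 * of_real pi * \<i> / of_nat N)"

lemma unity_root_power:
  "unity_root N ^ j = exp (of_nat j * (- 2 * of_real pi * \<i> / of_nat N))"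
  unfolding unity_root_def by (rule exp_of_nat_mult [symmetric])

lemma unity_root_power_self: "N > 0 \<Longrightarrow> unity_root N ^ N = 1"
  by (simp add: unity_root_power exp_minus)

lemma unity_root_power_cong:
  assumes "N > 0" "[j = k] (mod N)"
  shows "unity_root N ^ j = unity_root N ^ k"
proof -
  have *: "unity_root N ^ i = unity_root N ^ (i mod N)" for i
  proof -
    have "unity_root N ^ i = unity_root N ^ (N * (i div N) + i mod N)" by simp
    also have "\<dots> = unity_root N ^ (i mod N)"
      by (simp only: power_add power_mult unity_root_power_self[OF assms(1)] power_one mult_1_left)
    finally show ?thesis .
  qed
  show ?thesis using *[of j] *[of k] assms(2) by (simp add: cong_def)
qed

lemma unity_root_power_eq_1_iff:
  assumes "N > 0"
  shows "unity_root N ^ j = 1 \<longleftrightarrow> N dvd j"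
proof -
  have "unity_root N ^ j = unity_root N ^ (j mod N)"
    using assms by (intro unity_root_power_cong) (auto simp: cong_def)
  also have "\<dots> = inverse (cis (2 * pi * real (j mod N) / real N))"
    by (simp add: unity_root_power cis_conv_exp exp_minus [symmetric] mult_ac)
  also have "\<dots> = 1 \<longleftrightarrow> cis (2 * pi * real (j mod N) / real N) = cis (2 * pi * real 0 / real N)"
    by (simp only: inverse_eq_1_iff) simp
  also have "\<dots> \<longleftrightarrow> j mod N = 0"
    using bij_betw_imp_inj_on[OF Complex.bij_betw_roots_unity[OF assms]] assms
    by (subst inj_on_eq_iff) auto
  finally show ?thesis by (simp add: dvd_eq_mod_eq_0)
qed

lemma unity_root_mult:
  assumes "M > 0"
  shows "unity_root (N * M) ^ M = unity_root N"
  unfolding unity_root_power unfolding unity_root_def using assms by simp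

lemma sum_unity_root:
  assumes "N > 0"
  shows "(\<Sum>k<N. unity_root N ^ (k * j)) = (if N dvd j then of_nat N else 0)"
proof -
  have "(unity_root N ^ j) ^ N = 1"
    using assms by (metis mult.commute power_mult power_one unity_root_power_self)
  from sum_powers_root_of_unity[OF this] show ?thesis
    using assms by (simp add: unity_root_power_eq_1_iff power_mult [symmetric] mult.commute)
qed

lemma dft2_unity_root:
  "dft2 N1 N2 X k l =
     (\<Sum>m<N1. \<Sum>n<N2. of_int (X $$ (m, n)) * (unity_root N1 ^ (m * k) * unity_root N2 ^ (n * l)))"
  unfolding dft2_def
proof (intro sum.cong refl)
  fix m n
  show "of_int (X $$ (m, n)) * exp (- 2 * of_real pi * \<i> *
          (of_nat m * of_nat k / of_nat N1 + of_nat n * of_nat l / of_nat N2)) =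
        of_int (X $$ (m, n)) * (unity_root N1 ^ (m * k) * unity_root N2 ^ (n * l))"
    by (simp add: unity_root_power exp_add [symmetric] algebra_simps)
qed

lemma dft2_diff:
  assumes "X \<in> carrier_mat N1 N2" "Y \<in> carrier_mat N1 N2"
  shows "dft2 N1 N2 (X - Y) k l = dft2 N1 N2 X k l - dft2 N1 N2 Y k l"
  unfolding dft2_unity_root sum_subtractf [symmetric]
  using assms by (intro sum.cong refl) (auto simp: algebra_simps)

lemma dft2_cong:
  assumes "N1 > 0" "N2 > 0" "[k = k'] (mod N1)" "[l = l'] (mod N2)"
  shows "dft2 N1 N2 X k l = dft2 N1 N2 X k' l'"
  unfolding dft2_unity_root
proof (intro sum.cong refl)
  fix m n
  have "unity_root N1 ^ (m * k) = unity_root N1 ^ (m * k')"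
    using assms by (intro unity_root_power_cong cong_mult) auto
  moreover have "unity_root N2 ^ (n * l) = unity_root N2 ^ (n * l')"
    using assms by (intro unity_root_power_cong cong_mult) auto
  ultimately show "of_int (X $$ (m, n)) * (unity_root N1 ^ (m * k) * unity_root N2 ^ (n * l)) =
      of_int (X $$ (m, n)) * (unity_root N1 ^ (m * k') * unity_root N2 ^ (n * l'))" by simp
qed

text \<open>Both coefficients come from one integer polynomial, evaluated at a root of unity \<open>w\<close> of order
  \<open>N1 * N2\<close> and at \<open>w ^ r\<close>, since \<open>w ^ N2\<close> and \<open>w ^ N1\<close> are the roots that belong to \<open>N1\<close> and \<open>N2\<close>.\<close>
lemma dft2_zero_unit_multiple:
  assumes "N1 > 0" "N2 > 0" "coprime r (N1 * N2)" "dft2 N1 N2 X k l = 0"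
  shows "dft2 N1 N2 X (r * k) (r * l) = 0"
proof -
  define w where "w = unity_root (N1 * N2)"
  define P where "P = (\<Sum>m<N1. \<Sum>n<N2. monom (X $$ (m, n)) (N2 * (m * k) + N1 * (n * l)))"
  have w1: "w ^ N2 = unity_root N1"
    unfolding w_def by (rule unity_root_mult) fact
  have w2: "w ^ N1 = unity_root N2"
    unfolding w_def mult.commute[of N1] by (rule unity_root_mult) fact
  have P_eval: "eval_at P (w ^ s) = dft2 N1 N2 X (s * k) (s * l)" for s
    unfolding P_def eval_at_sum eval_at_monom dft2_unity_root
  proof (intro sum.cong refl)
    fix m n
    have "(w ^ s) ^ (N2 * (m * k) + N1 * (n * l)) =
        (w ^ N2) ^ (m * (s * k)) * (w ^ N1) ^ (n * (s * l))"
      unfolding power_mult [symmetric] power_add [symmetric]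
      by (rule arg_cong[where f = "\<lambda>e. w ^ e"]) (simp add: algebra_simps)
    thus "of_int (X $$ (m, n)) * (w ^ s) ^ (N2 * (m * k) + N1 * (n * l)) =
        of_int (X $$ (m, n)) * (unity_root N1 ^ (m * (s * k)) * unity_root N2 ^ (n * (s * l)))"
      by (simp only: w1 w2)
  qed
  have "w ^ (N1 * N2) = 1"
    unfolding w_def using assms by (intro unity_root_power_self) simp
  moreover have "eval_at P w = 0" using P_eval[of 1] assms(4) by simp
  ultimately have "eval_at P (w ^ r) = 0"
    using assms by (intro coprime_power_map_preserves_vanishing[of w "N1 * N2"]) auto
  thus ?thesis by (simp only: P_eval)
qed

lemma double_sum_exchange:
  fixes G :: "'a \<Rightarrow> 'b \<Rightarrow> 'e::comm_semiring_0"
  shows "(\<Sum>k\<in>K. \<Sum>l\<in>L. F k l * (\<Sum>m\<in>A. \<Sum>n\<in>B. G m n * H k l m n)) =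
         (\<Sum>m\<in>A. \<Sum>n\<in>B. G m n * (\<Sum>k\<in>K. \<Sum>l\<in>L. F k l * H k l m n))"
proof -
  have double: "(\<Sum>i\<in>I. \<Sum>j\<in>J. f i j) = (\<Sum>x\<in>I \<times> J. f (fst x) (snd x))"
    for I :: "'i set" and J :: "'j set" and f :: "'i \<Rightarrow> 'j \<Rightarrow> 'e"
    by (simp add: sum.cartesian_product case_prod_beta)
  have "(\<Sum>k\<in>K. \<Sum>l\<in>L. F k l * (\<Sum>m\<in>A. \<Sum>n\<in>B. G m n * H k l m n)) =
      (\<Sum>x\<in>K \<times> L. F (fst x) (snd x) *
        (\<Sum>m\<in>A. \<Sum>n\<in>B. G m n * H (fst x) (snd x) m n))"
    by (rule double)
  also have "\<dots> = (\<Sum>x\<in>K \<times> L. \<Sum>m\<in>A. \<Sum>n\<in>B.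
        F (fst x) (snd x) * (G m n * H (fst x) (snd x) m n))"
    by (simp only: sum_distrib_left)
  also have "\<dots> = (\<Sum>m\<in>A. \<Sum>x\<in>K \<times> L. \<Sum>n\<in>B.
        F (fst x) (snd x) * (G m n * H (fst x) (snd x) m n))"
    by (rule sum.swap)
  also have "\<dots> = (\<Sum>m\<in>A. \<Sum>n\<in>B. \<Sum>x\<in>K \<times> L.
        F (fst x) (snd x) * (G m n * H (fst x) (snd x) m n))"
    by (intro sum.cong refl sum.swap)
  also have "\<dots> = (\<Sum>m\<in>A. \<Sum>n\<in>B. G m n *
        (\<Sum>x\<in>K \<times> L. F (fst x) (snd x) * H (fst x) (snd x) m n))"
    by (simp only: sum_distrib_left mult.left_commute)
  also have "\<dots> = (\<Sum>m\<in>A. \<Sum>n\<in>B. G m n * (\<Sum>k\<in>K. \<Sum>l\<in>L. F k l * H k l m n))"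
    by (simp only: double)
  finally show ?thesis .
qed

text \<open>Fourier inversion. The conjugate of \<open>unity_root N1 ^ (k * a)\<close> is written as
  \<open>unity_root N1 ^ (k * (N1 - a))\<close>, so that all exponents remain natural numbers.\<close>
lemma dft2_eq_0_imp_zero:
  assumes N: "N1 > 0" "N2 > 0"
    and zero: "\<And>k l. k < N1 \<Longrightarrow> l < N2 \<Longrightarrow> dft2 N1 N2 X k l = 0"
    and ab: "a < N1" "b < N2"
  shows "X $$ (a, b) = 0"
proof -
  let ?u = "unity_root N1" and ?v = "unity_root N2"
  have dvd_iff: "M dvd m + (M - c) \<longleftrightarrow> m = c" if "m < M" "c < M" for m M c :: nat
  proof
    assume "M dvd m + (M - c)"
    then obtain q where q: "m + (M - c) = M * q" by (blast elim: dvdE)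
    have "0 < M * q" "M * q < M * 2" using that unfolding q [symmetric] by auto
    hence "q = 1" by auto
    with q that show "m = c" by simp
  qed (use that in auto)
  have factor: "(\<Sum>k<N1. \<Sum>l<N2. (?u ^ (k * c) * ?v ^ (l * d)) * (?u ^ (m * k) * ?v ^ (n * l))) =
      (\<Sum>k<N1. ?u ^ (k * (m + c))) * (\<Sum>l<N2. ?v ^ (l * (n + d)))" for m n c d
    unfolding sum_product
    by (intro sum.cong refl) (simp only: add_mult_distrib2 power_add mult_ac)
  have "0 = (\<Sum>k<N1. \<Sum>l<N2. (?u ^ (k * (N1 - a)) * ?v ^ (l * (N2 - b))) * dft2 N1 N2 X k l)"
    using zero by simp
  also have "\<dots> = (\<Sum>m<N1. \<Sum>n<N2. of_int (X $$ (m, n)) *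
      (\<Sum>k<N1. \<Sum>l<N2. (?u ^ (k * (N1 - a)) * ?v ^ (l * (N2 - b))) * (?u ^ (m * k) * ?v ^ (n * l))))"
    unfolding dft2_unity_root by (rule double_sum_exchange)
  also have "\<dots> = (\<Sum>m<N1. \<Sum>n<N2. of_int (X $$ (m, n)) *
      ((\<Sum>k<N1. ?u ^ (k * (m + (N1 - a)))) * (\<Sum>l<N2. ?v ^ (l * (n + (N2 - b))))))"
    by (simp only: factor)
  also have "\<dots> = (\<Sum>m<N1. \<Sum>n<N2. of_int (X $$ (m, n)) *
      (if m = a then of_nat N1 else 0) * (if n = b then of_nat N2 else 0))"
    using ab by (intro sum.cong refl) (simp only: sum_unity_root[OF N(1)] sum_unity_root[OF N(2)] lessThan_iff dvd_iff mult.assoc)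
  also have "\<dots> = (\<Sum>m<N1. if m = a then of_int (X $$ (m, b)) * of_nat N1 * of_nat N2 else 0)"
    using ab by (intro sum.cong refl) (simp add: if_distrib[of "\<lambda>x. _ * x"] cong: if_cong)
  also have "\<dots> = of_int (X $$ (a, b)) * of_nat N1 * of_nat N2"
    using ab by simp
  finally show ?thesis using N by simp
qed

section \<open>Cyclic subgroups of the frequency group\<close>

lemma (in group) cyclic_subgroups_eq_powers:
  "cyclic_subgroups G = (\<lambda>x. range (\<lambda>n::int. x [^] n)) ` carrier G"
proof (intro equalityI subsetI)
  fix H assume "H \<in> cyclic_subgroups G"
  hence H: "subgroup H G" "cyclic_group (G\<lparr>carrier := H\<rparr>)"
    by (auto simp: cyclic_subgroups_def)
  interpret H: group "G\<lparr>carrier := H\<rparr>"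
    using H(1) by (rule subgroup_imp_group)
  from H(2) obtain x where x: "x \<in> H" "H = range (\<lambda>n::int. x [^]\<^bsub>G\<lparr>carrier := H\<rparr>\<^esub> n)"
    by (auto simp: H.cyclic_group)
  have "H = range (\<lambda>n::int. x [^] n)"
    using x int_pow_consistent[OF H(1) x(1)] by simp
  thus "H \<in> (\<lambda>x. range (\<lambda>n::int. x [^] n)) ` carrier G"
    using x(1) subgroup.subset[OF H(1)] by blast
next
  fix H assume "H \<in> (\<lambda>x. range (\<lambda>n::int. x [^] n)) ` carrier G"
  then obtain x where x: "x \<in> carrier G" and Hx: "H = range (\<lambda>n::int. x [^] n)" by blast
  have sub: "subgroup H G" unfolding Hx by (rule subgroup_of_powers) fact
  interpret H: group "G\<lparr>carrier := H\<rparr>"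
    using sub by (rule subgroup_imp_group)
  have "x \<in> H" unfolding Hx using x by (metis int_pow_1 rangeI)
  have "range (\<lambda>n::int. x [^]\<^bsub>G\<lparr>carrier := H\<rparr>\<^esub> n) = H"
    unfolding int_pow_consistent[OF sub \<open>x \<in> H\<close>, symmetric] Hx [symmetric] ..
  with \<open>x \<in> H\<close> have "\<exists>x\<in>carrier (G\<lparr>carrier := H\<rparr>). carrier (G\<lparr>carrier := H\<rparr>) =
      range (\<lambda>n::int. x [^]\<^bsub>G\<lparr>carrier := H\<rparr>\<^esub> n)"
    by (intro bexI[of _ x]) simp_all
  hence "cyclic_group (G\<lparr>carrier := H\<rparr>)" unfolding H.cyclic_group .
  with sub show "H \<in> cyclic_subgroups G" by (simp add: cyclic_subgroups_def)
qed

lemma int_pow_DirProd: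
  assumes "group G" "group H" "x \<in> carrier G" "y \<in> carrier H"
  shows "(x, y) [^]\<^bsub>G \<times>\<times> H\<^esub> (n::int) = (x [^]\<^bsub>G\<^esub> n, y [^]\<^bsub>H\<^esub> n)"
proof -
  have prod: "group (G \<times>\<times> H)" using assms by (intro DirProd_group)
  have "group_hom (G \<times>\<times> H) G fst" "group_hom (G \<times>\<times> H) H snd"
    using assms prod by (auto intro!: group_hom.intro group_hom_axioms.intro homI)
  from this[THEN group_hom.hom_int_pow, of "(x, y)" n] assms show ?thesis
    by (simp add: prod_eq_iff)
qed

text \<open>The cyclic subgroup generated by a frequency. The argument is a pair of natural numbers, as in the
  transform, while the multiples are integers, as in the group.\<close>
definition multiples :: "nat \<Rightarrow> nat \<Rightarrow> nat \<times> nat \<Rightarrow> (int \<times> int) set" where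
  "multiples N1 N2 = (\<lambda>(k, l). range (\<lambda>r::int. (r * int k mod int N1, r * int l mod int N2)))"

lemma cyclic_subgroups_eq_multiples:
  assumes "N1 > 0" "N2 > 0"
  shows "cyclic_subgroups (integer_mod_group N1 \<times>\<times> integer_mod_group N2) =
         multiples N1 N2 ` ({..<N1} \<times> {..<N2})"
proof -
  let ?G = "integer_mod_group N1 \<times>\<times> integer_mod_group N2"
  interpret G: group ?G by (intro DirProd_group) auto
  have pow: "range (\<lambda>n::int. (int k, int l) [^]\<^bsub>?G\<^esub> n) = multiples N1 N2 (k, l)"
    if "k < N1" "l < N2" for k l
    using that by (simp add: multiples_def int_pow_DirProd carrier_integer_mod_group
        int_pow_integer_mod_group)
  have "carrier ?G = (\<lambda>(k, l). (int k, int l)) ` ({..<N1} \<times> {..<N2})"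
  proof -
    have "{0..<int M} = int ` {..<M}" for M
      using image_int_atLeastLessThan[of 0 M] by (simp add: lessThan_atLeast0)
    thus ?thesis using assms by (auto simp: carrier_integer_mod_group)
  qed
  hence "cyclic_subgroups ?G =
      (\<lambda>x. range (\<lambda>n::int. x [^]\<^bsub>?G\<^esub> n)) ` (\<lambda>(k, l). (int k, int l)) ` ({..<N1} \<times> {..<N2})"
    by (simp only: G.cyclic_subgroups_eq_powers)
  also have "\<dots> = multiples N1 N2 ` ({..<N1} \<times> {..<N2})"
    unfolding image_image
  proof (intro image_cong refl)
    fix x assume "x \<in> {..<N1} \<times> {..<N2}"
    then obtain k l where "x = (k, l)" "k < N1" "l < N2" by auto
    thus "range (\<lambda>n::int. (case x of (k, l) \<Rightarrow> (int k, int l)) [^]\<^bsub>?G\<^esub> n) = multiples N1 N2 x"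
      by (simp only: prod.case pow)
  qed
  finally show ?thesis .
qed

lemma multiples_subset:
  assumes "[int k' = r * int k] (mod int N1)" "[int l' = r * int l] (mod int N2)"
  shows "multiples N1 N2 (k', l') \<subseteq> multiples N1 N2 (k, l)"
proof
  fix x assume "x \<in> multiples N1 N2 (k', l')"
  then obtain s where "x = (s * int k' mod int N1, s * int l' mod int N2)"
    by (auto simp: multiples_def)
  moreover have "[s * int k' = (s * r) * int k] (mod int N1)"
    using cong_scalar_left[OF assms(1), of s] by (simp add: mult.assoc)
  moreover have "[s * int l' = (s * r) * int l] (mod int N2)"
    using cong_scalar_left[OF assms(2), of s] by (simp add: mult.assoc)
  ultimately show "x \<in> multiples N1 N2 (k, l)"
    by (auto simp: multiples_def cong_def)
qed

lemma multiples_eq_if_unit_multiple: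
  assumes "coprime r (int (N1 * N2))"
    and "[int k' = r * int k] (mod int N1)" "[int l' = r * int l] (mod int N2)"
  shows "multiples N1 N2 (k', l') = multiples N1 N2 (k, l)"
proof
  show "multiples N1 N2 (k', l') \<subseteq> multiples N1 N2 (k, l)"
    using assms(2,3) by (rule multiples_subset)
  obtain s where s: "[r * s = 1] (mod int (N1 * N2))"
    using cong_solve_coprime_int[OF assms(1)] by blast
  have inv: "[int j = s * int j'] (mod int M)"
    if "[int j' = r * int j] (mod int M)" "M dvd N1 * N2" for j j' M
  proof -
    have "int M dvd int (N1 * N2)" using that(2) by (simp only: of_nat_dvd_iff)
    hence "[r * s = 1] (mod int M)" by (rule cong_dvd_modulus[OF s])
    hence "[r * s * int j = 1 * int j] (mod int M)" by (rule cong_scalar_right)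
    moreover have "[s * int j' = s * (r * int j)] (mod int M)"
      using that(1) by (rule cong_scalar_left)
    ultimately have "[s * int j' = int j] (mod int M)"
      by (metis cong_trans mult.assoc mult.commute mult_1)
    thus ?thesis by (rule cong_sym)
  qed
  show "multiples N1 N2 (k, l) \<subseteq> multiples N1 N2 (k', l')"
    using assms(2,3) by (intro multiples_subset[of _ s] inv) auto
qed

text \<open>Write \<open>(k', l') = a (k, l)\<close> and \<open>(k, l) = b (k', l')\<close>. Then \<open>D = b a - 1\<close> annihilates \<open>(k, l)\<close>
  and is coprime to \<open>a\<close>, so every \<open>a + D t\<close> works as well as \<open>a\<close>, and one of these is
  coprime to \<open>N1 * N2\<close>.\<close>
lemma unit_multiple_if_multiples_eq:
  assumes "N1 > 0" "N2 > 0" and eq: "multiples N1 N2 (k', l') = multiples N1 N2 (k, l)"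
  obtains r where "coprime r (N1 * N2)" "[r * k = k'] (mod N1)" "[r * l = l'] (mod N2)"
proof -
  have self: "(int i mod int N1, int j mod int N2) \<in> multiples N1 N2 (i, j)" for i j
    unfolding multiples_def by (auto intro!: range_eqI[of _ _ 1])
  obtain a where a: "[int k' = a * int k] (mod int N1)" "[int l' = a * int l] (mod int N2)"
    using self[of k' l'] unfolding eq by (auto simp: multiples_def cong_def)
  obtain b where b: "[int k = b * int k'] (mod int N1)" "[int l = b * int l'] (mod int N2)"
    using self[of k l] unfolding eq [symmetric] by (auto simp: multiples_def cong_def)
  define D where "D = b * a - 1"
  have D: "[D * int i = 0] (mod int M)"
    if "[int i' = a * int i] (mod int M)" "[int i = b * int i'] (mod int M)" for i i' M
  proof -
    have "[b * int i' = b * (a * int i)] (mod int M)" using that(1) by (rule cong_scalar_left)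
    hence "[b * (a * int i) = int i] (mod int M)"
      using that(2) by (meson cong_sym cong_trans)
    thus ?thesis by (simp add: D_def cong_iff_dvd_diff algebra_simps)
  qed
  have "coprime a D"
  proof (rule coprimeI)
    fix c assume "c dvd a" "c dvd D"
    hence "c dvd b * a - D" by (intro dvd_diff dvd_mult)
    thus "is_unit c" by (simp add: D_def)
  qed
  then obtain t where t: "coprime (a + D * t) (int (N1 * N2))"
    using coprime_lift[of a D "N1 * N2"] assms by (metis nat_0_less_mult_iff)
  define r where "r = nat ((a + D * t) mod int (N1 * N2))"
  have r: "int r = (a + D * t) mod int (N1 * N2)"
    unfolding r_def using assms by (simp del: of_nat_mult)
  have "coprime (int r) (int (N1 * N2))"
    unfolding r using t assms by (simp del: of_nat_mult)
  hence 1: "coprime r (N1 * N2)" by (simp only: coprime_int_iff)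
  have main: "[r * i = i'] (mod M)"
    if "[int i' = a * int i] (mod int M)" "[int i = b * int i'] (mod int M)" "M dvd N1 * N2" for i i' M
  proof -
    have "int M dvd int (N1 * N2)" using that(3) by (simp only: of_nat_dvd_iff)
    moreover have "[int r = a + D * t] (mod int (N1 * N2))" unfolding r by (simp add: cong_def)
    ultimately have "[int r = a + D * t] (mod int M)" by (metis cong_dvd_modulus)
    hence "[int r * int i = (a + D * t) * int i] (mod int M)" by (rule cong_scalar_right)
    also have "(a + D * t) * int i = a * int i + t * (D * int i)" by (simp add: algebra_simps)
    also have "[\<dots> = int i' + t * 0] (mod int M)"
      by (intro cong_add cong_mult cong_refl D[OF that(1,2)] cong_sym[OF that(1)])
    finally show ?thesis by (simp flip: of_nat_mult add: cong_int_iff)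
  qed
  show ?thesis
    by (rule that[OF 1]) (use a b in \<open>auto intro!: main\<close>)
qed

section \<open>Sets of frequencies that suffice\<close>

text \<open>The entries of \<open>X\<close> are the Ramanujan sums \<open>R m n\<close>. With the sign convention of the transform, \<open>X\<close>
  is supported on the frequencies \<open>- r (k, l)\<close> for units \<open>r\<close>. The entry at \<open>(0, 0)\<close> counts the units
  modulo \<open>N1 * N2\<close>, so \<open>X\<close> is not zero.\<close>
lemma dft2_supported_on_generators:
  assumes N: "N1 > 0" "N2 > 0"
  obtains X where "X \<in> carrier_mat N1 N2" "X \<noteq> 0\<^sub>m N1 N2"
    "\<And>k' l'. dft2 N1 N2 X k' l' \<noteq> 0 \<Longrightarrow> multiples N1 N2 (k', l') = multiples N1 N2 (k, l)"
proof -
  define N where "N = N1 * N2"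
  have N_pos: "N > 0" using N by (simp add: N_def)
  let ?u = "unity_root N1" and ?v = "unity_root N2"
  let ?U = "{r. r < N \<and> coprime r N}"
  define R where "R m n = (\<Sum>r\<in>?U. ?u ^ (r * k * m) * ?v ^ (r * l * n))" for m n
  have fin: "finite ?U" by (rule finite_subset[of _ "{..<N}"]) auto
  have "R m n \<in> \<int>" for m n
  proof -
    define z where "z = ?u ^ (k * m) * ?v ^ (l * n)"
    have "(?u ^ (k * m)) ^ N = 1" "(?v ^ (l * n)) ^ N = 1"
      using N unfolding power_mult [symmetric]
      by (simp_all add: unity_root_power_eq_1_iff N_def)
    hence "z ^ N = 1"
      by (simp add: z_def power_mult_distrib)
    moreover have "R m n = (\<Sum>r\<in>?U. z ^ r)"
      unfolding R_def z_def power_mult_distrib power_mult [symmetric]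
      by (simp only: mult_ac)
    ultimately show ?thesis using sum_coprime_powers_in_Ints N_pos by simp
  qed
  hence "\<forall>m n. \<exists>c. of_int c = R m n" by (metis Ints_cases)
  then obtain c where c: "\<And>m n. of_int (c m n) = R m n" by metis
  define X where "X = mat N1 N2 (\<lambda>(m, n). c m n)"
  show ?thesis
  proof (rule that)
    show "X \<in> carrier_mat N1 N2" by (simp add: X_def)
  next
    \<comment> \<open>For \<open>N = 1\<close> the only unit below \<open>N\<close> is 0.\<close>
    have "1 mod N \<in> ?U" using N_pos by (simp add: coprime_mod_left_iff)
    hence "card ?U > 0" using fin card_gt_0_iff by blast
    moreover have "of_int (c 0 0) = (of_nat (card ?U) :: complex)"
      by (simp add: c R_def)
    ultimately have "c 0 0 \<noteq> 0" by (metis of_int_0 of_nat_eq_0_iff less_not_refl)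
    hence "X $$ (0, 0) \<noteq> 0" using N by (simp add: X_def)
    thus "X \<noteq> 0\<^sub>m N1 N2" using N by auto
  next
    fix k' l' assume nz: "dft2 N1 N2 X k' l' \<noteq> 0"
    have "dft2 N1 N2 X k' l' =
        (\<Sum>m<N1. \<Sum>n<N2. (\<Sum>r\<in>?U. ?u ^ (r * k * m) * ?v ^ (r * l * n)) * (?u ^ (m * k') * ?v ^ (n * l')))"
      unfolding dft2_unity_root by (intro sum.cong refl) (simp add: X_def c R_def)
    also have "\<dots> = (\<Sum>m<N1. \<Sum>n<N2. \<Sum>r\<in>?U. ?u ^ (m * (r * k + k')) * ?v ^ (n * (r * l + l')))"
      unfolding sum_distrib_right
      by (intro sum.cong refl) (simp only: add_mult_distrib2 power_add mult_ac)
    also have "\<dots> = (\<Sum>m<N1. \<Sum>r\<in>?U. \<Sum>n<N2. ?u ^ (m * (r * k + k')) * ?v ^ (n * (r * l + l')))"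
      by (intro sum.cong refl sum.swap)
    also have "\<dots> = (\<Sum>r\<in>?U. \<Sum>m<N1. \<Sum>n<N2. ?u ^ (m * (r * k + k')) * ?v ^ (n * (r * l + l')))"
      by (rule sum.swap)
    also have "\<dots> = (\<Sum>r\<in>?U. (\<Sum>m<N1. ?u ^ (m * (r * k + k'))) * (\<Sum>n<N2. ?v ^ (n * (r * l + l'))))"
      by (simp only: sum_product)
    finally obtain r where r: "r \<in> ?U"
      "(\<Sum>m<N1. ?u ^ (m * (r * k + k'))) * (\<Sum>n<N2. ?v ^ (n * (r * l + l'))) \<noteq> 0"
      using nz by (metis (no_types, lifting) sum.neutral)
    hence dvd: "N1 dvd r * k + k'" "N2 dvd r * l + l'"
      using N by (auto simp: sum_unity_root split: if_splits)
    have cong: "[int i' = (- int r) * int i] (mod int M)" if "M dvd r * i + i'" for M i i'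
    proof -
      have "int M dvd int (r * i + i')" using that by (simp only: of_nat_dvd_iff)
      thus ?thesis by (simp add: cong_iff_dvd_diff add.commute)
    qed
    have "coprime (- int r) (int (N1 * N2))"
      using r(1) by (simp add: N_def del: of_nat_mult)
    thus "multiples N1 N2 (k', l') = multiples N1 N2 (k, l)"
      by (rule multiples_eq_if_unit_multiple[OF _ cong[OF dvd(1)] cong[OF dvd(2)]])
  qed
qed

text \<open>Necessity: if \<open>S\<close> misses all generators of some subgroup, the matrix of
  \<open>dft2_supported_on_generators\<close> has the same coefficients on \<open>S\<close> as the zero matrix. Sufficiency:
  each frequency is a unit multiple of one in \<open>S\<close>, so vanishing on \<open>S\<close> spreads to all frequencies.\<close>
lemma suffices_for_recovery_iff:
  assumes "N1 > 0" and "N2 > 0"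
  shows "suffices_for_recovery N1 N2 S \<longleftrightarrow> S \<subseteq> {..<N1} \<times> {..<N2} \<and>
     multiples N1 N2 ` S = multiples N1 N2 ` ({..<N1} \<times> {..<N2})"
proof (intro iffI conjI)
  assume suff: "suffices_for_recovery N1 N2 S"
  show S: "S \<subseteq> {..<N1} \<times> {..<N2}"
    using suff by (simp add: suffices_for_recovery_def)
  have "multiples N1 N2 (k, l) \<in> multiples N1 N2 ` S" for k l
  proof (rule ccontr)
    assume notin: "multiples N1 N2 (k, l) \<notin> multiples N1 N2 ` S"
    obtain X where X: "X \<in> carrier_mat N1 N2" "X \<noteq> 0\<^sub>m N1 N2"
      and supp: "\<And>k' l'. dft2 N1 N2 X k' l' \<noteq> 0 \<Longrightarrow> multiples N1 N2 (k', l') = multiples N1 N2 (k, l)"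
      using dft2_supported_on_generators[OF assms, of k l] by metis
    have "dft2 N1 N2 (0\<^sub>m N1 N2) k' l' = 0" for k' l'
      by (simp add: dft2_unity_root)
    moreover have "dft2 N1 N2 X k' l' = 0" if "(k', l') \<in> S" for k' l'
      using notin supp that by (metis imageI)
    ultimately have "\<forall>(k', l')\<in>S. dft2 N1 N2 X k' l' = dft2 N1 N2 (0\<^sub>m N1 N2) k' l'"
      by auto
    hence "X = 0\<^sub>m N1 N2"
      using suff X(1) zero_carrier_mat unfolding suffices_for_recovery_def by blast
    with X(2) show False by contradiction
  qed
  hence "multiples N1 N2 ` ({..<N1} \<times> {..<N2}) \<subseteq> multiples N1 N2 ` S"
    by auto
  thus "multiples N1 N2 ` S = multiples N1 N2 ` ({..<N1} \<times> {..<N2})"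
    by (intro equalityI image_mono[OF S])
next
  assume S: "S \<subseteq> {..<N1} \<times> {..<N2} \<and>
     multiples N1 N2 ` S = multiples N1 N2 ` ({..<N1} \<times> {..<N2})"
  show "suffices_for_recovery N1 N2 S"
    unfolding suffices_for_recovery_def
  proof (intro conjI ballI impI)
    show "S \<subseteq> {..<N1} \<times> {..<N2}" using S by blast
    fix X Y :: "int mat"
    assume XY: "X \<in> carrier_mat N1 N2" "Y \<in> carrier_mat N1 N2"
      and eq: "\<forall>(k, l)\<in>S. dft2 N1 N2 X k l = dft2 N1 N2 Y k l"
    have zero: "dft2 N1 N2 (X - Y) k l = 0" if kl: "k < N1" "l < N2" for k l
    proof -
      have "multiples N1 N2 (k, l) \<in> multiples N1 N2 ` S" using S kl by blast
      then obtain i j where ij: "(i, j) \<in> S" "multiples N1 N2 (k, l) = multiples N1 N2 (i, j)"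
        by auto
      obtain r where r: "coprime r (N1 * N2)" "[r * i = k] (mod N1)" "[r * j = l] (mod N2)"
        using unit_multiple_if_multiples_eq[OF assms ij(2)] by blast
      have "dft2 N1 N2 (X - Y) i j = 0"
        using eq ij(1) XY by (auto simp: dft2_diff)
      hence "dft2 N1 N2 (X - Y) (r * i) (r * j) = 0"
        by (rule dft2_zero_unit_multiple[OF assms r(1)])
      thus ?thesis using dft2_cong[OF assms r(2,3)] by simp
    qed
    have "(X - Y) $$ (a, b) = 0" if "a < N1" "b < N2" for a b
      using dft2_eq_0_imp_zero[OF assms zero that] .
    hence "X $$ (a, b) = Y $$ (a, b)" if "a < N1" "b < N2" for a b
      using that XY by fastforce
    thus "X = Y" using XY by (intro eq_matI) auto
  qed
qed

theorem corollary3p10: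
  fixes N1 N2 :: nat
  assumes "N1 > 0" and "N2 > 0"
  shows "(\<exists>S. suffices_for_recovery N1 N2 S \<and>
            card S = card (cyclic_subgroups (integer_mod_group N1 \<times>\<times> integer_mod_group N2))) \<and>
         (\<forall>S. suffices_for_recovery N1 N2 S \<longrightarrow>
            card (cyclic_subgroups (integer_mod_group N1 \<times>\<times> integer_mod_group N2)) \<le> card S)"
proof (intro conjI allI impI)
  let ?C = "cyclic_subgroups (integer_mod_group N1 \<times>\<times> integer_mod_group N2)"
  have C: "?C = multiples N1 N2 ` ({..<N1} \<times> {..<N2})"
    using assms by (rule cyclic_subgroups_eq_multiples)
  hence "?C \<subseteq> multiples N1 N2 ` ({..<N1} \<times> {..<N2})" by simp
  then obtain S where S: "S \<subseteq> {..<N1} \<times> {..<N2}" "inj_on (multiples N1 N2) S"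
    "?C = multiples N1 N2 ` S"
    unfolding subset_image_inj by blast
  have "suffices_for_recovery N1 N2 S"
    using S C by (simp add: suffices_for_recovery_iff[OF assms])
  moreover have "card S = card ?C" using S by (simp add: card_image)
  ultimately show "\<exists>S. suffices_for_recovery N1 N2 S \<and> card S = card ?C" by blast
  fix S assume "suffices_for_recovery N1 N2 S"
  hence S: "S \<subseteq> {..<N1} \<times> {..<N2}" "?C = multiples N1 N2 ` S"
    using C by (simp_all add: suffices_for_recovery_iff[OF assms])
  have "finite S" using S(1) by (rule finite_subset) simp
  thus "card ?C \<le> card S" unfolding S(2) by (rule card_image_le)
qed

end
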